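(* Let $(D,\mathfrak{m})$ be a pseudo-valuation domain with associated valuation overring $V$, and let $E$ be a nonempty fractional subset of $D$ contained in $V$. If the residue field $D/\mathfrak{m}$ of $D$ is finite, then $$\dim(\mathrm{Int}^{\mathrm{R}}(E,D))=1+\dim(D).$$
   Context: Let $D$ be an integral domain with quotient field $K$. $D$ is a pseudo-valuation domain (PVD) if every prime ideal $\mathfrak{p}$ of $D$ has the property that whenever $x,y\in K$ and $xy\in\mathfrak{p}$, then $x\in\mathfrak{p}$ or $y\in\mathfrak{p}$. A PVD $D$ is local, with maximal ideal denoted $\mathfrak{m}$; its associated valuation overring $V$ is the valuation ring $V$ with $D\subseteq V\subseteq K$ whose maximal ideal is $\mathfrak{m}$ (so $V=D$ if $D$ is a valuation domain). A subset $E$ of $K$ is a fractional subset of $D$ if there is a nonzero $d\in D$ with $dE\subseteq D$. $\mathrm{Int}^{\mathrm{R}}(E,D)=\{\varphi\in K(X) : \varphi(E)\subseteq D\}$ is the ring of integer-valued rational functions on $E$ over $D$ (in particular $\varphi$ is required to be defined at each point of $E$). $\dim$ denotes Krull dimension. *)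

theory Defs
  imports
    "HOL-Algebra.Algebraic_Closure_Type"
    "HOL-Computational_Algebra.Fraction_Field"
    "HOL-Computational_Algebra.Polynomial"
    "HOL-Library.Extended_Nat"
begin

text \<open>
  Throughout, the quotient field \<open>K\<close> is a type of class \<^class>\<open>field\<close>, the rings
  \<open>D \<subseteq> V \<subseteq> K\<close> are subsets of it, and \<open>K(X)\<close> is the type of fractions of
  polynomials over \<open>K\<close>. The following abbreviation views such a subset as a ring of HOL-Algebra,
  so that prime and maximal ideals and quotient rings are those of that library.
\<close>

abbreviation ring_on :: "'a::comm_ring_1 set \<Rightarrow> 'a ring"
  where "ring_on S \<equiv> ring_of_type_algebra\<lparr>carrier := S\<rparr>"

definition domain_with_quotient_field :: "'k::field set \<Rightarrow> bool"
  where "domain_with_quotient_field D \<longleftrightarrow>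
    subdomain D ring_of_type_algebra \<and> (\<forall>x. \<exists>a\<in>D. \<exists>b\<in>D. b \<noteq> 0 \<and> x = a / b)"

definition pseudo_valuation_domain :: "'k::field set \<Rightarrow> bool"
  where "pseudo_valuation_domain D \<longleftrightarrow>
    domain_with_quotient_field D \<and>
    (\<forall>P. primeideal P (ring_on D) \<longrightarrow> (\<forall>x y. x * y \<in> P \<longrightarrow> x \<in> P \<or> y \<in> P))"

definition valuation_ring :: "'k::field set \<Rightarrow> bool"
  where "valuation_ring V \<longleftrightarrow>
    subdomain V ring_of_type_algebra \<and> (\<forall>x. x \<noteq> 0 \<longrightarrow> x \<in> V \<or> inverse x \<in> V)"

text \<open>
  A valuation ring is local, so that \<open>m\<close> being a maximal ideal of \<open>V\<close> means that
  it is the maximal ideal of \<open>V\<close>.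
\<close>

definition associated_valuation_overring :: "'k::field set \<Rightarrow> 'k set \<Rightarrow> 'k set \<Rightarrow> bool"
  where "associated_valuation_overring D m V \<longleftrightarrow>
    valuation_ring V \<and> D \<subseteq> V \<and> maximalideal m (ring_on V)"

definition fractional_subset :: "'k::field set \<Rightarrow> 'k set \<Rightarrow> bool"
  where "fractional_subset D E \<longleftrightarrow> (\<exists>d\<in>D. d \<noteq> 0 \<and> (\<forall>e\<in>E. d * e \<in> D))"

text \<open>
  A rational function is defined at \<open>a\<close> if some representation of it as a fraction has a
  denominator not vanishing at \<open>a\<close>; the representation need not be reduced. The value does
  not depend on the representation (lemma \<open>ratfun_eval_Fract\<close>).
\<close>

definition ratfun_defined_at :: "'k::field poly fract \<Rightarrow> 'k \<Rightarrow> bool"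
  where "ratfun_defined_at \<phi> a \<longleftrightarrow>
    (\<exists>p q. \<phi> = Fraction_Field.Fract p q \<and> poly q a \<noteq> 0)"

definition ratfun_eval :: "'k::field poly fract \<Rightarrow> 'k \<Rightarrow> 'k"
  where "ratfun_eval \<phi> a =
    (THE b. \<exists>p q. \<phi> = Fraction_Field.Fract p q \<and> poly q a \<noteq> 0 \<and> b = poly p a / poly q a)"

definition Int_R :: "'k::field set \<Rightarrow> 'k set \<Rightarrow> 'k poly fract set"
  where "Int_R E D = {\<phi>. \<forall>a\<in>E. ratfun_defined_at \<phi> a \<and> ratfun_eval \<phi> a \<in> D}"

text \<open>
  The dimension of the zero ring, which has no prime ideals, comes out as \<open>0\<close>; only domains
  are considered here.
\<close>

definition krull_dim :: "('a, 'b) ring_scheme \<Rightarrow> enat"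
  where "krull_dim R = Sup {enat n | n. \<exists>P :: nat \<Rightarrow> 'a set.
    (\<forall>i\<le>n. primeideal (P i) R) \<and> (\<forall>i<n. P i \<subset> P (Suc i))}"

lemma ratfun_eval_Fract:
  assumes "poly q a \<noteq> 0"
  shows "ratfun_eval (Fraction_Field.Fract p q) a = poly p a / poly q a"
  unfolding ratfun_eval_def
proof (rule the_equality)
  fix b
  assume "\<exists>p' q'. Fraction_Field.Fract p q = Fraction_Field.Fract p' q' \<and>
    poly q' a \<noteq> 0 \<and> b = poly p' a / poly q' a"
  then obtain p' q' where eq: "Fraction_Field.Fract p q = Fraction_Field.Fract p' q'"
    and q': "poly q' a \<noteq> 0" and b: "b = poly p' a / poly q' a" by blast
  from assms q' have "q \<noteq> 0" "q' \<noteq> 0" by auto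
  with eq have "p * q' = p' * q" by (simp add: eq_fract)
  then have "poly p a * poly q' a = poly p' a * poly q a" by (metis poly_mult)
  with assms q' show "b = poly p a / poly q a" by (simp add: b frac_eq_eq)
qed (use assms in blast)

lemma Int_R_iff:
  "\<phi> \<in> Int_R E D \<longleftrightarrow>
    (\<forall>a\<in>E. \<exists>p q. \<phi> = Fraction_Field.Fract p q \<and> poly q a \<noteq> 0 \<and> poly p a / poly q a \<in> D)"
  unfolding Int_R_def ratfun_defined_at_def
  by (auto simp: ratfun_eval_Fract) (metis ratfun_eval_Fract)+

lemma subring_type_algebra_iff:
  "subring S (ring_of_type_algebra :: 'a::comm_ring_1 ring) \<longleftrightarrow>
    1 \<in> S \<and> (\<forall>x\<in>S. - x \<in> S) \<and> (\<forall>x\<in>S. \<forall>y\<in>S. x + y \<in> S) \<and> (\<forall>x\<in>S. \<forall>y\<in>S. x * y \<in> S)"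
proof -
  interpret R: ring "ring_of_type_algebra :: 'a ring" by (rule ring_from_type_algebra)
  have inv: "\<ominus>\<^bsub>ring_of_type_algebra\<^esub> x = - x" for x :: 'a
    by (rule R.minus_equality) (simp_all add: ring_of_type_algebra_def)
  show ?thesis
  proof
    assume S: "subring S (ring_of_type_algebra :: 'a ring)"
    show "1 \<in> S \<and> (\<forall>x\<in>S. - x \<in> S) \<and> (\<forall>x\<in>S. \<forall>y\<in>S. x + y \<in> S) \<and> (\<forall>x\<in>S. \<forall>y\<in>S. x * y \<in> S)"
      using subringE(3,5,6,7)[OF S] inv by (auto simp: ring_of_type_algebra_def)
  next
    assume "1 \<in> S \<and> (\<forall>x\<in>S. - x \<in> S) \<and> (\<forall>x\<in>S. \<forall>y\<in>S. x + y \<in> S) \<and> (\<forall>x\<in>S. \<forall>y\<in>S. x * y \<in> S)"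
    then show "subring S (ring_of_type_algebra :: 'a ring)"
      by (intro R.subringI) (simp_all only: inv, auto simp: ring_of_type_algebra_def)
  qed
qed

lemma subring_Int_R:
  assumes "subring D (ring_of_type_algebra :: 'k::field ring)"
  shows "subring (Int_R E D) ring_of_type_algebra"
proof -
  have D: "1 \<in> D" "\<And>x. x \<in> D \<Longrightarrow> - x \<in> D" "\<And>x y. x \<in> D \<Longrightarrow> y \<in> D \<Longrightarrow> x + y \<in> D"
    "\<And>x y. x \<in> D \<Longrightarrow> y \<in> D \<Longrightarrow> x * y \<in> D"
    using assms by (auto simp: subring_type_algebra_iff)
  have closed: "\<phi> + \<psi> \<in> Int_R E D \<and> \<phi> * \<psi> \<in> Int_R E D"
    if "\<phi> \<in> Int_R E D" "\<psi> \<in> Int_R E D" for \<phi> \<psi>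
  proof -
    have "(\<exists>p q. \<phi> + \<psi> = Fraction_Field.Fract p q \<and> poly q a \<noteq> 0 \<and> poly p a / poly q a \<in> D) \<and>
      (\<exists>p q. \<phi> * \<psi> = Fraction_Field.Fract p q \<and> poly q a \<noteq> 0 \<and> poly p a / poly q a \<in> D)"
      if "a \<in> E" for a
    proof -
      obtain p q where 1: "\<phi> = Fraction_Field.Fract p q" "poly q a \<noteq> 0" "poly p a / poly q a \<in> D"
        using \<open>\<phi> \<in> _\<close> \<open>a \<in> E\<close> unfolding Int_R_iff by blast
      obtain r s where 2: "\<psi> = Fraction_Field.Fract r s" "poly s a \<noteq> 0" "poly r a / poly s a \<in> D"
        using \<open>\<psi> \<in> _\<close> \<open>a \<in> E\<close> unfolding Int_R_iff by blast
      have "q \<noteq> 0" "s \<noteq> 0" using 1 2 by auto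
      then have "\<phi> + \<psi> = Fraction_Field.Fract (p * s + r * q) (q * s)"
        and "\<phi> * \<psi> = Fraction_Field.Fract (p * r) (q * s)" using 1 2 by auto
      moreover have "poly (q * s) a \<noteq> 0" using 1 2 by simp
      moreover have "poly (p * s + r * q) a / poly (q * s) a \<in> D"
        using D(3)[OF 1(3) 2(3)] 1 2 by (simp add: add_frac_eq mult.commute)
      moreover have "poly (p * r) a / poly (q * s) a \<in> D"
        using D(4)[OF 1(3) 2(3)] by simp
      ultimately show ?thesis by blast
    qed
    then show ?thesis unfolding Int_R_iff by blast
  qed
  have one: "1 \<in> Int_R E D"
    unfolding Int_R_iff One_fract_def using D(1)
    by (intro ballI exI[of _ 1]) simp
  have "- 1 \<in> Int_R E D"
    unfolding Int_R_iff One_fract_def minus_fract using D(1,2)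
    by (intro ballI exI[of _ "- 1"] exI[of _ 1]) simp
  then have "- \<phi> \<in> Int_R E D" if "\<phi> \<in> Int_R E D" for \<phi>
    using closed[of "- 1" \<phi>] that by simp
  with one closed show ?thesis by (auto simp: subring_type_algebra_iff)
qed

end

theory Submission
  imports Defs "HOL-Computational_Algebra.Polynomial_Factorial"
begin

text \<open>
  Write \<open>R = Int_R E D\<close>, \<open>T = Int_R E V\<close> and \<open>J = Int_R E m\<close>. For \<open>a \<in> E\<close>, evaluation at \<open>a\<close> pulls a
  chain of primes of \<open>D\<close> back to \<open>R\<close>, and \<open>0\<close> can be added below it.

  Conversely, \<open>J\<close> is an ideal of both \<open>R\<close> and \<open>T\<close>, so the primes of \<open>R\<close> not containing \<open>J\<close> lift to \<open>T\<close>.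
  Since \<open>D/m\<close> is finite, only the top prime of a chain in \<open>R\<close> can contain \<open>J\<close>; since \<open>1 + J\<close> consists of
  units of \<open>T\<close>, the lifted chain can be extended by a proper ideal meeting \<open>J\<close> outside the lifted
  primes. As \<open>V \<subseteq> T \<subseteq> K(X)\<close> and \<open>K(X)\<close> has transcendence degree one over \<open>K\<close>, the traces on \<open>V\<close> of a
  chain in \<open>T\<close> repeat at most once, and traces of proper ideals lie in \<open>m \<subseteq> D\<close>, so they form a chain in \<open>D\<close>.
\<close>

subsection \<open>Ideals of rings of type-class elements\<close>

lemma ring_on_simps:
  "carrier (ring_on S) = S" "x \<otimes>\<^bsub>ring_on S\<^esub> y = x * y" "x \<oplus>\<^bsub>ring_on S\<^esub> y = x + y"
  "\<one>\<^bsub>ring_on S\<^esub> = 1" "\<zero>\<^bsub>ring_on S\<^esub> = 0"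
  by (simp_all add: ring_of_type_algebra_def)

lemma cring_ring_on:
  assumes "subring S ring_of_type_algebra"
  shows "cring (ring_on S)"
proof -
  interpret cring "ring_of_type_algebra :: 'a ring"
    by (rule cring_from_type_algebra)
  show ?thesis
    using subcring_iff[of S] subcringI'[OF assms] subringE(1)[OF assms] by blast
qed

text \<open>Negation is absent from the right-hand side because it is multiplication by
  \<open>- 1\<close>, which lies in \<open>S\<close>.\<close>

lemma ideal_ring_on_iff:
  assumes S: "subring S ring_of_type_algebra"
  shows "ideal I (ring_on S) \<longleftrightarrow>
    I \<subseteq> S \<and> 0 \<in> I \<and> (\<forall>x\<in>I. \<forall>y\<in>I. x + y \<in> I) \<and> (\<forall>s\<in>S. \<forall>x\<in>I. s * x \<in> I)"
proof -
  interpret R: cring "ring_on S" by (rule cring_ring_on[OF S])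
  show ?thesis
  proof
    assume "ideal I (ring_on S)"
    then interpret ideal I "ring_on S" .
    show "I \<subseteq> S \<and> 0 \<in> I \<and> (\<forall>x\<in>I. \<forall>y\<in>I. x + y \<in> I) \<and> (\<forall>s\<in>S. \<forall>x\<in>I. s * x \<in> I)"
      using a_subset zero_closed a_closed I_l_closed unfolding ring_on_simps by blast
  next
    assume I: "I \<subseteq> S \<and> 0 \<in> I \<and> (\<forall>x\<in>I. \<forall>y\<in>I. x + y \<in> I) \<and> (\<forall>s\<in>S. \<forall>x\<in>I. s * x \<in> I)"
    have "- 1 \<in> S"
      using S by (auto simp: subring_type_algebra_iff)
    with I have minus: "- x \<in> I" if "x \<in> I" for x
      using that by (metis mult_minus1)
    have inv: "\<ominus>\<^bsub>ring_on S\<^esub> x = - x" if "x \<in> I" for x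
      by (rule R.minus_equality) (use I minus that in \<open>auto simp: ring_of_type_algebra_def\<close>)
    show "ideal I (ring_on S)"
    proof (rule idealI[OF R.ring_axioms])
      show "subgroup I (add_monoid (ring_on S))"
      proof (rule R.add.subgroupI)
        show "\<ominus>\<^bsub>ring_on S\<^esub> x \<in> I" if "x \<in> I" for x
          using inv minus that by simp
      qed (use I in \<open>auto simp: ring_of_type_algebra_def\<close>)
    qed (use I in \<open>simp_all add: ring_of_type_algebra_def, (metis mult.commute)+\<close>)
  qed
qed

lemma primeideal_ring_on_iff:
  assumes S: "subring S ring_of_type_algebra"
  shows "primeideal P (ring_on S) \<longleftrightarrow>
    P \<subseteq> S \<and> 0 \<in> P \<and> (\<forall>x\<in>P. \<forall>y\<in>P. x + y \<in> P) \<and> (\<forall>s\<in>S. \<forall>x\<in>P. s * x \<in> P) \<and>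
    1 \<notin> P \<and> (\<forall>x\<in>S. \<forall>y\<in>S. x * y \<in> P \<longrightarrow> x \<in> P \<or> y \<in> P)"
proof -
  have one: "1 \<in> S"
    using S by (auto simp: subring_type_algebra_iff)
  show ?thesis (is "_ \<longleftrightarrow> ?R")
  proof
    assume P: "primeideal P (ring_on S)"
    then have I: "ideal P (ring_on S)"
      by (rule primeideal.axioms)
    have "S \<noteq> P"
      using primeideal.I_notcarr[OF P] by (simp add: ring_on_simps)
    then have "1 \<notin> P"
      using I unfolding ideal_ring_on_iff[OF S] by (metis mult.right_neutral subsetI subset_antisym)
    with I show ?R
      using primeideal.I_prime[OF P] unfolding ideal_ring_on_iff[OF S] ring_on_simps by blast
  next
    assume P: ?R
    then have "ideal P (ring_on S)"
      by (simp add: ideal_ring_on_iff[OF S])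
    then show "primeideal P (ring_on S)"
      by (rule primeidealI[OF _ cring_ring_on[OF S]])
        (use P one in \<open>auto simp: ring_of_type_algebra_def\<close>)
  qed
qed

text \<open>The elements \<open>c * y + \<mu>\<close> form an ideal \<open>J\<close> containing
  \<open>m\<close> and also \<open>c\<close>, so maximality forces \<open>J\<close> to be all of
  \<open>S\<close>.\<close>

lemma maximalideal_ring_on_comaximal:
  assumes S: "subring S ring_of_type_algebra" and m: "maximalideal m (ring_on S)"
    and c: "c \<in> S" "c \<notin> m"
  shows "\<exists>y\<in>S. \<exists>\<mu>\<in>m. c * y + \<mu> = 1"
proof -
  have S': "1 \<in> S" "\<And>x y. x \<in> S \<Longrightarrow> y \<in> S \<Longrightarrow> x + y \<in> S" "\<And>x y. x \<in> S \<Longrightarrow> y \<in> S \<Longrightarrow> x * y \<in> S"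
    using S by (auto simp: subring_type_algebra_iff)
  have "ideal m (ring_on S)"
    using m by (rule maximalideal.axioms)
  then have m': "m \<subseteq> S" "0 \<in> m" "\<And>x y. x \<in> m \<Longrightarrow> y \<in> m \<Longrightarrow> x + y \<in> m"
      "\<And>x y. x \<in> S \<Longrightarrow> y \<in> m \<Longrightarrow> x * y \<in> m"
    by (auto simp: ideal_ring_on_iff[OF S])
  have 0: "0 \<in> S"
    using m' by blast
  define J where "J = {c * y + \<mu> | y \<mu>. y \<in> S \<and> \<mu> \<in> m}"
  have "ideal J (ring_on S)"
    unfolding ideal_ring_on_iff[OF S]
  proof (intro conjI ballI)
    show "J \<subseteq> S"
      using S' m' c unfolding J_def by blast
    show "0 \<in> J"
      unfolding J_def using m' 0 by force
    show "x + y \<in> J" if "x \<in> J" "y \<in> J" for x y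
    proof -
      from that obtain a \<mu> b \<nu> where "x = c * a + \<mu>" "y = c * b + \<nu>" "a \<in> S" "b \<in> S" "\<mu> \<in> m" "\<nu> \<in> m"
        unfolding J_def by blast
      then have "x + y = c * (a + b) + (\<mu> + \<nu>)" "a + b \<in> S" "\<mu> + \<nu> \<in> m"
        using S' m' by (auto simp: algebra_simps)
      then show ?thesis
        unfolding J_def by blast
    qed
    show "s * x \<in> J" if "s \<in> S" "x \<in> J" for s x
    proof -
      from that obtain a \<mu> where "x = c * a + \<mu>" "a \<in> S" "\<mu> \<in> m"
        unfolding J_def by blast
      then have "s * x = c * (s * a) + s * \<mu>" "s * a \<in> S" "s * \<mu> \<in> m"
        using S' m' \<open>s \<in> S\<close> by (auto simp: distrib_left mult.left_commute)
      then show ?thesis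
        unfolding J_def by blast
    qed
  qed
  moreover have "m \<subseteq> J"
    unfolding J_def using 0 by force
  moreover have "J \<subseteq> carrier (ring_on S)"
    using S' m' c unfolding J_def ring_on_simps by blast
  ultimately have "J = m \<or> J = S"
    using maximalideal.I_maximal[OF m] unfolding ring_on_simps by blast
  moreover have "c \<in> J"
    unfolding J_def using m'(2) S'(1) by force
  ultimately have "1 \<in> J"
    using c S'(1) by blast
  then show ?thesis
    unfolding J_def by (smt (verit) mem_Collect_eq)
qed

text \<open>Comaximality gives \<open>x * y + \<mu> = 1\<close> with \<open>\<mu>\<close> in
  \<open>m\<close>, and the valuation property compares \<open>\<mu>\<close> with \<open>x\<close>.
  If \<open>\<mu> / x\<close> is in \<open>V\<close>, then \<open>y + \<mu> / x\<close> is the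
  inverse of \<open>x\<close>; if \<open>x / \<mu>\<close> is in \<open>V\<close>, then
  \<open>x\<close> would be a multiple of \<open>\<mu>\<close> and hence lie in
  \<open>m\<close>.\<close>

lemma valuation_ring_maximalideal_inverse:
  assumes V: "valuation_ring V" and m: "maximalideal m (ring_on V)"
    and x: "x \<in> V" "x \<notin> m"
  shows "inverse x \<in> V"
proof -
  have S: "subring V ring_of_type_algebra"
    using V unfolding valuation_ring_def by (auto dest: subdomain.axioms subcring.axioms)
  have S': "1 \<in> V" "\<And>x y. x \<in> V \<Longrightarrow> y \<in> V \<Longrightarrow> x + y \<in> V" "\<And>x y. x \<in> V \<Longrightarrow> y \<in> V \<Longrightarrow> x * y \<in> V"
    "\<And>x. x \<in> V \<Longrightarrow> - x \<in> V"
    using S by (auto simp: subring_type_algebra_iff)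
  have "ideal m (ring_on V)"
    using m by (rule maximalideal.axioms)
  then have m': "m \<subseteq> V" "0 \<in> m" "\<And>x y. x \<in> V \<Longrightarrow> y \<in> m \<Longrightarrow> x * y \<in> m"
    by (auto simp: ideal_ring_on_iff[OF S])
  have "m \<noteq> V"
    using maximalideal.I_notcarr[OF m] by (simp add: ring_on_simps)
  then have one: "1 \<notin> m"
    using m' by (metis mult.right_neutral subsetI subset_antisym)
  obtain y \<mu> where y: "y \<in> V" "\<mu> \<in> m" "x * y + \<mu> = 1"
    using maximalideal_ring_on_comaximal[OF S m x] by blast
  have "x \<noteq> 0"
    using x m' by blast
  show ?thesis
  proof (cases "\<mu> = 0")
    case True
    then have "inverse x = y"
      using y by (intro inverse_unique) simp
    then show ?thesis
      using y by simp
  next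
    case False
    show ?thesis
    proof (cases "\<mu> / x \<in> V")
      case True
      have "inverse x = y + \<mu> / x"
        using y(3) \<open>x \<noteq> 0\<close> by (simp add: field_simps)
      then show ?thesis
        using S' y True by simp
    next
      case False
      then have "x / \<mu> \<in> V"
        using V \<open>\<mu> \<noteq> 0\<close> \<open>x \<noteq> 0\<close> unfolding valuation_ring_def
        by (metis divide_eq_0_iff inverse_divide)
      then have "x / \<mu> * \<mu> \<in> m"
        using m' y by blast
      then show ?thesis
        using x \<open>\<mu> \<noteq> 0\<close> by simp
    qed
  qed
qed

subsection \<open>Traces on a valuation ring of primes in a ring of rational functions\<close>

definition const_ratfun :: "'k::field \<Rightarrow> 'k poly fract"
  where "const_ratfun c = to_fract [:c:]"

lemma const_ratfun_simps [simp]: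
  "const_ratfun 0 = 0" "const_ratfun 1 = 1"
  "const_ratfun (c + d) = const_ratfun c + const_ratfun d"
  "const_ratfun (c * d) = const_ratfun c * const_ratfun d"
  "const_ratfun (- c) = - const_ratfun c"
  by (simp_all add: const_ratfun_def flip: to_fract_add to_fract_mult to_fract_uminus one_pCons)

text \<open>Gaussian elimination, by induction on the number \<open>M\<close> of equations: an
  unknown \<open>i0\<close> occurring in the last equation is eliminated from the others, which
  leaves one equation and one unknown fewer.\<close>

lemma ex_nontrivial_solution:
  fixes f :: "'i \<Rightarrow> nat \<Rightarrow> 'k::field"
  assumes "finite I" "M < card I"
  shows "\<exists>c. (\<exists>i\<in>I. c i \<noteq> 0) \<and> (\<forall>j<M. (\<Sum>i\<in>I. c i * f i j) = 0)"
  using assms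
proof (induction M arbitrary: I f)
  case 0
  then have "I \<noteq> {}"
    by auto
  then have "\<exists>i\<in>I. (1::'k) \<noteq> 0"
    by auto
  then show ?case
    by (intro exI[of _ "\<lambda>_. 1"]) simp
next
  case (Suc M)
  show ?case
  proof (cases "\<forall>i\<in>I. f i M = 0")
    case True
    then show ?thesis
      using Suc.IH[of I f] Suc.prems by (auto simp: less_Suc_eq)
  next
    case False
    then obtain i0 where i0: "i0 \<in> I" "f i0 M \<noteq> 0"
      by blast
    define I' where "I' = I - {i0}"
    have I: "I = insert i0 I'" "i0 \<notin> I'" "finite I'" "M < card I'"
      using i0 Suc.prems by (auto simp: I'_def card_Diff_singleton)
    obtain c where c: "\<exists>i\<in>I'. c i \<noteq> 0"
      "\<And>j. j < M \<Longrightarrow> (\<Sum>i\<in>I'. c i * (f i j - f i M / f i0 M * f i0 j)) = 0"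
      using Suc.IH[OF I(3,4), of "\<lambda>i j. f i j - f i M / f i0 M * f i0 j"] by blast
    \<comment> \<open>The last equation forces the value \<open>- s\<close> on the eliminated
      unknown. Substituting it back turns every other equation into its reduced form.\<close>
    define s where "s = (\<Sum>i\<in>I'. c i * f i M) / f i0 M"
    define c' where "c' = c(i0 := - s)"
    have "(\<Sum>i\<in>I. c' i * f i j) = 0" if "j < Suc M" for j
    proof -
      have "(\<Sum>i\<in>I. c' i * f i j) = (\<Sum>i\<in>I'. c' i * f i j) - s * f i0 j"
        using I by (simp add: c'_def)
      also have "(\<Sum>i\<in>I'. c' i * f i j) = (\<Sum>i\<in>I'. c i * f i j)"
        using I by (intro sum.cong) (auto simp: c'_def)
      also have "\<dots> - s * f i0 j = (\<Sum>i\<in>I'. c i * (f i j - f i M / f i0 M * f i0 j))"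
        by (simp add: s_def right_diff_distrib sum_subtractf sum_divide_distrib sum_distrib_right mult.assoc)
      also have "\<dots> = 0"
      proof (cases "j = M")
        case True
        then show ?thesis
          using i0 by simp
      qed (use c(2) that in simp)
      finally show ?thesis .
    qed
    moreover have "\<exists>i\<in>I. c' i \<noteq> 0"
      using c(1) I by (auto simp: c'_def)
    ultimately show ?thesis
      by blast
  qed
qed

section \<open>Algebraic dependence of two rational functions over \<open>K\<close>\<close>

lemma degree_mult_le': "degree p \<le> m \<Longrightarrow> degree q \<le> n \<Longrightarrow> degree (p * q) \<le> m + n"
  for p q :: "'k::field poly"
  using degree_mult_le[of p q] by simp

lemma degree_power_le': "degree p \<le> m \<Longrightarrow> degree (p ^ n) \<le> m * n"
  for p :: "'k::field poly"
  using degree_power_le[of p n] by (meson le_trans mult_le_mono1)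

text \<open>Among the monomials in \<open>a\<close> and \<open>b\<close> of degree at most \<open>N\<close> in each variable, written over a
  common denominator, the number grows quadratically in \<open>N\<close> and the degree of the numerators
  linearly.\<close>

lemma ratfun_algebraic_dependence:
  fixes a b :: "'k::field poly fract"
  shows "\<exists>N c. (\<exists>k\<le>N. \<exists>l\<le>N. c k l \<noteq> 0) \<and>
    (\<Sum>k\<le>N. (\<Sum>l\<le>N. const_ratfun (c k l) * b ^ l) * a ^ k) = 0"
proof -
  obtain p q where a: "a = Fraction_Field.Fract p q" "q \<noteq> 0"
    by (cases a) auto
  obtain r s where b: "b = Fraction_Field.Fract r s" "s \<noteq> 0"
    by (cases b) auto
  define d where "d = degree p + degree q + (degree r + degree s)"
  \<comment> \<open>With this \<open>N\<close> there are \<open>(d + 2)^2\<close> monomials, more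
    than the \<open>d * (d + 1) + 1\<close> coefficients that have to vanish.\<close>
  define N where "N = Suc d"
  define I where "I = {..N} \<times> {..N}"
  \<comment> \<open>\<open>P (k, l)\<close> is the numerator of \<open>a ^ k * b ^ l\<close> over
    the common denominator \<open>q ^ N * s ^ N\<close>.\<close>
  define P where "P = (\<lambda>(k, l). (p ^ k * q ^ (N - k)) * (r ^ l * s ^ (N - l)))"
  have deg: "degree (P i) \<le> d * N" if "i \<in> I" for i
  proof -
    obtain k l where i: "i = (k, l)" "k \<le> N" "l \<le> N"
      using \<open>i \<in> I\<close> unfolding I_def by auto
    have "degree (P i) \<le> (degree p * k + degree q * (N - k)) + (degree r * l + degree s * (N - l))"
      unfolding i P_def prod.case by (intro degree_mult_le' degree_power_le' order_refl)
    also have "\<dots> \<le> (degree p * N + degree q * N) + (degree r * N + degree s * N)"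
      using i by (intro add_mono mult_le_mono2) auto
    also have "\<dots> = d * N"
      by (simp add: d_def algebra_simps)
    finally show ?thesis .
  qed
  have "finite I" "d * N + 1 < card I"
    by (simp_all add: I_def N_def)
  then obtain c where c: "\<exists>i\<in>I. c i \<noteq> 0" "\<And>j. j < d * N + 1 \<Longrightarrow> (\<Sum>i\<in>I. c i * coeff (P i) j) = 0"
    using ex_nontrivial_solution[of I "d * N + 1" "\<lambda>i. coeff (P i)"] by blast
  have "(\<Sum>i\<in>I. [:c i:] * P i) = 0"
  proof (rule poly_eqI)
    fix j
    show "coeff (\<Sum>i\<in>I. [:c i:] * P i) j = coeff 0 j"
    proof (cases "j < d * N + 1")
      case True
      then show ?thesis
        using c(2) by (simp add: coeff_sum)
    next
      case False
      then have "coeff (P i) j = 0" if "i \<in> I" for i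
        using deg[OF that] by (intro coeff_eq_0) simp
      then show ?thesis
        by (simp add: coeff_sum)
    qed
  qed
  then have "0 = to_fract (\<Sum>i\<in>I. [:c i:] * P i)"
    by simp
  also have "\<dots> = (\<Sum>i\<in>I. const_ratfun (c i) * to_fract (P i))"
    by (simp only: const_ratfun_def to_fract_sum to_fract_mult)
  also have "\<dots> = (\<Sum>k\<le>N. \<Sum>l\<le>N. const_ratfun (c (k, l)) * to_fract (P (k, l)))"
    unfolding I_def by (simp add: sum.cartesian_product)
  also have "\<dots> = (\<Sum>k\<le>N. (\<Sum>l\<le>N. const_ratfun (c (k, l)) * b ^ l) * a ^ k) *
    (to_fract q ^ N * to_fract s ^ N)"
    unfolding sum_distrib_right
  proof (intro sum.cong refl)
    fix k l assume "k \<in> {..N}" "l \<in> {..N}"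
    then have kl: "k \<le> N" "l \<le> N"
      by auto
    have pow: "to_fract (x ^ n) = to_fract x ^ n" for x :: "'k poly" and n
      by (induction n) auto
    have num: "to_fract (x ^ n * y ^ (N - n)) = (to_fract x / to_fract y) ^ n * to_fract y ^ N"
      if "y \<noteq> 0" "n \<le> N" for x y :: "'k poly" and n
    proof -
      have "to_fract y ^ N = to_fract y ^ n * to_fract y ^ (N - n)"
        using \<open>n \<le> N\<close> by (simp flip: power_add)
      then show ?thesis
        using \<open>y \<noteq> 0\<close> by (simp add: pow power_divide)
    qed
    have "to_fract (p ^ k * q ^ (N - k)) = a ^ k * to_fract q ^ N"
      "to_fract (r ^ l * s ^ (N - l)) = b ^ l * to_fract s ^ N"
      by (simp_all only: num[OF a(2) kl(1)] num[OF b(2) kl(2)] a(1) b(1) Fract_conv_to_fract)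
    then show "const_ratfun (c (k, l)) * to_fract (P (k, l)) =
        const_ratfun (c (k, l)) * b ^ l * a ^ k * (to_fract q ^ N * to_fract s ^ N)"
      by (simp add: P_def)
  qed
  finally have "(\<Sum>k\<le>N. (\<Sum>l\<le>N. const_ratfun (c (k, l)) * b ^ l) * a ^ k) = 0"
    using a b by simp
  moreover have "\<exists>k\<le>N. \<exists>l\<le>N. c (k, l) \<noteq> 0"
    using c(1) by (auto simp: I_def)
  ultimately show ?thesis
    by (intro exI[of _ N] exI[of _ "\<lambda>k l. c (k, l)"]) blast
qed

text \<open>Divisibility over a valuation ring is total, so a finite family has a member dividing
  all the others. Division by it normalizes a relation: all coefficients then lie in
  \<open>V\<close> and one of them is 1.\<close>

lemma valuation_ring_ex_dividing:
  assumes V: "valuation_ring V" and "finite I" "\<exists>i\<in>I. c i \<noteq> 0"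
  shows "\<exists>i\<in>I. c i \<noteq> 0 \<and> (\<forall>j\<in>I. c j / c i \<in> V)"
  using assms(2,3)
proof (induction I rule: finite_induct)
  case (insert x I)
  have S: "subring V ring_of_type_algebra"
    using V unfolding valuation_ring_def by (auto dest: subdomain.axioms subcring.axioms)
  have V': "1 \<in> V" "\<And>x y. x \<in> V \<Longrightarrow> y \<in> V \<Longrightarrow> x * y \<in> V"
    using S by (auto simp: subring_type_algebra_iff)
  have "- 1 \<in> V" "\<And>x y. x \<in> V \<Longrightarrow> y \<in> V \<Longrightarrow> x + y \<in> V"
    using S V'(1) by (auto simp: subring_type_algebra_iff)
  then have zero: "0 \<in> V"
    using V'(1) by (metis add.right_inverse)
  have self: "c i / c i \<in> V" for i
    using V' zero by (cases "c i = 0") auto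
  show ?case
  proof (cases "\<exists>i\<in>I. c i \<noteq> 0")
    case False
    then have "c x \<noteq> 0" "\<forall>j\<in>I. c j = 0"
      using insert.prems by auto
    then show ?thesis
      using zero self V'(1) by auto
  next
    case True
    then obtain i where i: "i \<in> I" "c i \<noteq> 0" "\<forall>j\<in>I. c j / c i \<in> V"
      using insert.IH by blast
    show ?thesis
    proof (cases "c x / c i \<in> V")
      case True
      then show ?thesis
        using i by auto
    next
      case False
      then have x: "c x \<noteq> 0"
        using zero by auto
      have "c i / c x \<in> V"
        using V i x False unfolding valuation_ring_def by (metis divide_eq_0_iff inverse_divide)
      then have "c j / c i * (c i / c x) \<in> V" if "j \<in> I" for j
        using V' i that by blast
      then show ?thesis
        using i x self by auto
    qed
  qed
qed simp

section \<open>Finite sums, products and polynomial expressions in rings and ideals\<close>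

lemma power_closed_ring_on:
  fixes T :: "'a::comm_ring_1 set"
  assumes "subring T ring_of_type_algebra" "b \<in> T"
  shows "b ^ n \<in> T"
  using assms by (induction n) (auto simp: subring_type_algebra_iff)

lemma sum_closed_ideal:
  assumes "subring T ring_of_type_algebra" "ideal I (ring_on T)" "\<And>i. i \<in> A \<Longrightarrow> f i \<in> I"
  shows "sum f A \<in> I"
  using assms(3) assms(2)[unfolded ideal_ring_on_iff[OF assms(1)]]
  by (induction A rule: infinite_finite_induct) auto

lemma sum_closed_ring_on:
  fixes T :: "'a::comm_ring_1 set"
  assumes "subring T ring_of_type_algebra" "\<And>i. i \<in> A \<Longrightarrow> f i \<in> T"
  shows "sum f A \<in> T"
proof -
  have "ideal T (ring_on T)"
    using ring.oneideal[OF cring.axioms(1)[OF cring_ring_on[OF assms(1)]]]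
    by (simp add: ring_on_simps)
  then show ?thesis
    using sum_closed_ideal assms by blast
qed

lemma prod_closed_ring_on:
  fixes T :: "'a::comm_ring_1 set"
  assumes "subring T ring_of_type_algebra" "\<And>i. i \<in> A \<Longrightarrow> f i \<in> T"
  shows "prod f A \<in> T"
  using assms(2) assms(1)[unfolded subring_type_algebra_iff]
  by (induction A rule: infinite_finite_induct) auto

text \<open>The first coefficient outside \<open>Q\<close> is found by peeling off constant terms.
  The whole sum and every multiple of \<open>b\<close> lie in \<open>Q'\<close>, hence so does
  \<open>g 0\<close>. If \<open>g 0\<close> is even in \<open>Q\<close>, then \<open>Q\<close>
  contains \<open>b\<close> times the remaining sum, and \<open>b\<close> can be cancelled because
  \<open>Q\<close> is prime and does not contain it.\<close>

lemma polynomial_in_prime_coeff: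
  assumes T: "subring T ring_of_type_algebra"
    and Q: "primeideal Q (ring_on T)" and Q': "ideal Q' (ring_on T)" "Q \<subseteq> Q'"
    and b: "b \<in> Q'" "b \<notin> Q"
    and g: "\<And>k. k \<le> N \<Longrightarrow> g k \<in> T" and sum: "(\<Sum>k\<le>N. g k * b ^ k) \<in> Q"
  shows "(\<forall>k\<le>N. g k \<in> Q) \<or> (\<exists>k\<le>N. g k \<in> Q' - Q)"
  using g sum
proof (induction N arbitrary: g)
  case (Suc N)
  note QT = Q[unfolded primeideal_ring_on_iff[OF T]] and Q'T = Q'(1)[unfolded ideal_ring_on_iff[OF T]]
  have bT: "b \<in> T"
    using Q'T b by blast
  have "- 1 \<in> T"
    using T by (auto simp: subring_type_algebra_iff)
  define S where "S = (\<Sum>k\<le>N. g (Suc k) * b ^ k)"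
  have mult: "x * y \<in> T" if "x \<in> T" "y \<in> T" for x y
    using T that by (auto simp: subring_type_algebra_iff)
  have "S \<in> T"
    unfolding S_def using Suc.prems(1) power_closed_ring_on[OF T bT]
    by (intro sum_closed_ring_on[OF T] mult) auto
  have eq: "(\<Sum>k\<le>Suc N. g k * b ^ k) = g 0 + b * S"
    unfolding S_def sum.atMost_Suc_shift by (simp add: sum_distrib_left mult_ac)
  show ?case
  proof (cases "g 0 \<in> Q")
    case True
    have "(g 0 + b * S) + - 1 * g 0 \<in> Q"
      using QT True Suc.prems(2) \<open>- 1 \<in> T\<close> unfolding eq by blast
    then have "b * S \<in> Q"
      by simp
    then have "S \<in> Q"
      using QT b bT \<open>S \<in> T\<close> by blast
    then have "(\<forall>k\<le>N. g (Suc k) \<in> Q) \<or> (\<exists>k\<le>N. g (Suc k) \<in> Q' - Q)"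
      unfolding S_def by (intro Suc.IH) (use Suc.prems in auto)
    then show ?thesis
      using True by (metis Suc_le_mono not0_implies_Suc)
  next
    case False
    have "S * b \<in> Q'"
      using Q'T b \<open>S \<in> T\<close> by blast
    then have "(g 0 + b * S) + - 1 * (S * b) \<in> Q'"
      using Q'T Q'(2) Suc.prems(2) \<open>- 1 \<in> T\<close> unfolding eq by blast
    then have "g 0 \<in> Q'"
      by (simp add: mult.commute)
    then show ?thesis
      using False by blast
  qed
qed auto

text \<open>Elements of \<open>Q2 - Q1\<close> and \<open>Q4 - Q3\<close> would be algebraically independent over \<open>K\<close>.\<close>

lemma not_two_repeated_traces:
  fixes V :: "'k::field set" and T :: "'k poly fract set"
  assumes V: "valuation_ring V" and T: "subring T ring_of_type_algebra"
    and VT: "\<And>c. c \<in> V \<Longrightarrow> const_ratfun c \<in> T"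
    and Q1: "primeideal Q1 (ring_on T)" and Q2: "primeideal Q2 (ring_on T)"
    and Q3: "primeideal Q3 (ring_on T)" and Q4: "ideal Q4 (ring_on T)"
    and sub: "Q1 \<subset> Q2" "Q2 \<subseteq> Q3" "Q3 \<subset> Q4"
    and trace: "\<And>c. c \<in> V \<Longrightarrow> const_ratfun c \<in> Q2 \<Longrightarrow> const_ratfun c \<in> Q1"
      "\<And>c. c \<in> V \<Longrightarrow> const_ratfun c \<in> Q4 \<Longrightarrow> const_ratfun c \<in> Q3"
  shows False
proof -
  note Q1T = Q1[unfolded primeideal_ring_on_iff[OF T]]
    and Q2T = Q2[unfolded primeideal_ring_on_iff[OF T]]
    and Q3T = Q3[unfolded primeideal_ring_on_iff[OF T]]
    and Q4T = Q4[unfolded ideal_ring_on_iff[OF T]]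
  have I: "ideal Q1 (ring_on T)" "ideal Q2 (ring_on T)"
    using Q1 Q2 by (auto dest: primeideal.axioms)
  have mult: "x * y \<in> T" if "x \<in> T" "y \<in> T" for x y
    using T that by (auto simp: subring_type_algebra_iff)
  obtain a b where a: "a \<in> Q2" "a \<notin> Q1" and b: "b \<in> Q4" "b \<notin> Q3"
    using sub by blast
  have bT: "b \<in> T"
    using b Q4T by blast
  obtain N c where c: "\<exists>k\<le>N. \<exists>l\<le>N. c k l \<noteq> 0"
    and rel: "(\<Sum>k\<le>N. (\<Sum>l\<le>N. const_ratfun (c k l) * b ^ l) * a ^ k) = 0"
    using ratfun_algebraic_dependence[of b a] by blast
  obtain i0 where i0: "i0 \<in> {..N} \<times> {..N}" "case_prod c i0 \<noteq> 0"
    "\<forall>j\<in>{..N} \<times> {..N}. case_prod c j / case_prod c i0 \<in> V"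
    using valuation_ring_ex_dividing[OF V, of "{..N} \<times> {..N}" "case_prod c"] c by fastforce
  \<comment> \<open>Dividing by the coefficient at \<open>(k0, l0)\<close> makes the relation one
    over \<open>V\<close> with a coefficient equal to 1, so its coefficients cannot all lie in a
    proper ideal.\<close>
  obtain k0 l0 where kl0: "i0 = (k0, l0)"
    by (cases i0)
  define e where "e k l = c k l / c k0 l0" for k l
  have kl0': "k0 \<le> N" "l0 \<le> N" "e k0 l0 = 1"
    using i0 by (auto simp: kl0 e_def)
  have eV: "e k l \<in> V" if "k \<le> N" "l \<le> N" for k l
    using i0(3) that by (auto simp: kl0 e_def)
  define g where "g k = (\<Sum>l\<le>N. const_ratfun (e k l) * b ^ l)" for k
  have gT: "g k \<in> T" if "k \<le> N" for k
    unfolding g_def using eV that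
    by (intro sum_closed_ring_on[OF T] mult VT power_closed_ring_on[OF T bT]) auto
  have "(\<Sum>k\<le>N. g k * a ^ k) =
    const_ratfun (inverse (c k0 l0)) * (\<Sum>k\<le>N. (\<Sum>l\<le>N. const_ratfun (c k l) * b ^ l) * a ^ k)"
    by (simp add: g_def e_def divide_inverse sum_distrib_left sum_distrib_right mult_ac)
  then have "(\<Sum>k\<le>N. g k * a ^ k) \<in> Q1"
    using rel Q1T by simp
  \<comment> \<open>The relation is first read as a polynomial in \<open>a\<close> with coefficients
    \<open>g k\<close> in \<open>T\<close>. Either way it yields some \<open>g k\<close> in
    \<open>Q2\<close> with a constant coefficient outside \<open>Q1\<close>: the coefficient 1 in
    the first case; in the second, if all constants of row \<open>k\<close> were in
    \<open>Q1\<close>, so would be \<open>g k\<close>.\<close>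
  then have "(\<forall>k\<le>N. g k \<in> Q1) \<or> (\<exists>k\<le>N. g k \<in> Q2 - Q1)"
    using psubset_imp_subset[OF sub(1)] a gT by (intro polynomial_in_prime_coeff[OF T Q1 I(2)])
  then obtain k l where k: "k \<le> N" "g k \<in> Q2" and l: "l \<le> N" "const_ratfun (e k l) \<notin> Q1"
  proof (elim disjE exE conjE)
    assume "\<forall>k\<le>N. g k \<in> Q1"
    then show thesis
      using that[of k0 l0] kl0' sub Q1T by auto
  next
    fix k assume k: "k \<le> N" "g k \<in> Q2 - Q1"
    have "\<exists>l\<le>N. const_ratfun (e k l) \<notin> Q1"
    proof (rule ccontr)
      assume contra: "\<not> ?thesis"
      have "b ^ l * const_ratfun (e k l) \<in> Q1" if "l \<le> N" for l
        using contra that Q1T power_closed_ring_on[OF T bT] by blast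
      then have "g k \<in> Q1"
        unfolding g_def by (intro sum_closed_ideal[OF T I(1)]) (simp add: mult.commute)
      then show False
        using k by blast
    qed
    then show thesis
      using that k by blast
  qed
  have "e k l \<noteq> 0"
    using l Q1T by auto
  \<comment> \<open>Row \<open>k\<close> is normalized once more, by its own dividing coefficient
    \<open>e k l1\<close>, so that the resulting polynomial in \<open>b\<close> has a coefficient
    equal to 1.\<close>
  then obtain l1 where l1: "l1 \<le> N" "e k l1 \<noteq> 0" "\<And>j. j \<le> N \<Longrightarrow> e k j / e k l1 \<in> V"
    using valuation_ring_ex_dividing[OF V, of "{..N}" "e k"] l(1) by auto
  define f where "f j = e k j / e k l1" for j
  have f: "e k j = f j * e k l1" for j
    using l1 by (simp add: f_def)
  have fV: "f j \<in> V" if "j \<le> N" for j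
    using l1 that by (simp add: f_def)
  \<comment> \<open>The divisor \<open>e k l1\<close> can be cancelled from \<open>g k\<close> in
    \<open>Q2\<close>: if it were in \<open>Q2\<close>, so would be its multiple
    \<open>e k l\<close>, which is outside \<open>Q1\<close> and hence, by equality of traces,
    outside \<open>Q2\<close>.\<close>
  have "const_ratfun (e k l1) \<notin> Q2"
  proof
    assume "const_ratfun (e k l1) \<in> Q2"
    then have "const_ratfun (f l) * const_ratfun (e k l1) \<in> Q2"
      using Q2T VT[OF fV[OF l(1)]] by blast
    then have "const_ratfun (e k l) \<in> Q2"
      by (simp add: f[of l])
    then show False
      using trace(1) eV[OF k(1) l(1)] l(2) by blast
  qed
  moreover have "const_ratfun (e k l1) * (\<Sum>j\<le>N. const_ratfun (f j) * b ^ j) = g k"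
    unfolding g_def sum_distrib_left
  proof (intro sum.cong refl)
    fix j
    show "const_ratfun (e k l1) * (const_ratfun (f j) * b ^ j) = const_ratfun (e k j) * b ^ j"
      by (subst (2) f) (simp add: mult_ac)
  qed
  moreover have "(\<Sum>j\<le>N. const_ratfun (f j) * b ^ j) \<in> T"
    by (intro sum_closed_ring_on[OF T] mult VT power_closed_ring_on[OF T bT]) (auto intro: fV)
  ultimately have "(\<Sum>j\<le>N. const_ratfun (f j) * b ^ j) \<in> Q3"
    using Q2T k VT[OF eV[OF k(1) l1(1)]] sub(2) by (metis subsetD)
  \<comment> \<open>The same descent is now made along \<open>b\<close> from \<open>Q3\<close> to
    \<open>Q4\<close>. The coefficient \<open>f l1 = 1\<close> excludes the first alternative, and
    the second contradicts the equality of the traces of \<open>Q3\<close> and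
    \<open>Q4\<close>.\<close>
  then have "(\<forall>j\<le>N. const_ratfun (f j) \<in> Q3) \<or> (\<exists>j\<le>N. const_ratfun (f j) \<in> Q4 - Q3)"
    using psubset_imp_subset[OF sub(3)] b VT[OF fV]
    by (intro polynomial_in_prime_coeff[OF T Q3 Q4])
  moreover have "const_ratfun (f l1) \<notin> Q3"
    using l1 Q3T by (simp add: f_def)
  ultimately show False
    using trace(2) fV l1(1) by blast
qed

subsection \<open>Integer-valued rational functions\<close>

lemma ratfun_eval_add:
  assumes "ratfun_defined_at \<phi> a" "ratfun_defined_at \<psi> a"
  shows "ratfun_defined_at (\<phi> + \<psi>) a" "ratfun_eval (\<phi> + \<psi>) a = ratfun_eval \<phi> a + ratfun_eval \<psi> a"
proof -
  obtain p q r s where \<phi>: "\<phi> = Fraction_Field.Fract p q" "poly q a \<noteq> 0"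
    and \<psi>: "\<psi> = Fraction_Field.Fract r s" "poly s a \<noteq> 0"
    using assms unfolding ratfun_defined_at_def by blast
  then have "q \<noteq> 0" "s \<noteq> 0" "poly (q * s) a \<noteq> 0"
    by auto
  then have eq: "\<phi> + \<psi> = Fraction_Field.Fract (p * s + r * q) (q * s)"
    using \<phi> \<psi> by simp
  show "ratfun_defined_at (\<phi> + \<psi>) a"
    unfolding ratfun_defined_at_def using eq \<open>poly (q * s) a \<noteq> 0\<close> by blast
  show "ratfun_eval (\<phi> + \<psi>) a = ratfun_eval \<phi> a + ratfun_eval \<psi> a"
    unfolding eq ratfun_eval_Fract[OF \<open>poly (q * s) a \<noteq> 0\<close>]
    using \<phi> \<psi> by (simp add: ratfun_eval_Fract add_frac_eq mult.commute)
qed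

lemma ratfun_eval_mult:
  assumes "ratfun_defined_at \<phi> a" "ratfun_defined_at \<psi> a"
  shows "ratfun_defined_at (\<phi> * \<psi>) a" "ratfun_eval (\<phi> * \<psi>) a = ratfun_eval \<phi> a * ratfun_eval \<psi> a"
proof -
  obtain p q r s where \<phi>: "\<phi> = Fraction_Field.Fract p q" "poly q a \<noteq> 0"
    and \<psi>: "\<psi> = Fraction_Field.Fract r s" "poly s a \<noteq> 0"
    using assms unfolding ratfun_defined_at_def by blast
  then have "poly (q * s) a \<noteq> 0"
    by auto
  have eq: "\<phi> * \<psi> = Fraction_Field.Fract (p * r) (q * s)"
    using \<phi> \<psi> by simp
  show "ratfun_defined_at (\<phi> * \<psi>) a"
    unfolding ratfun_defined_at_def using eq \<open>poly (q * s) a \<noteq> 0\<close> by blast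
  show "ratfun_eval (\<phi> * \<psi>) a = ratfun_eval \<phi> a * ratfun_eval \<psi> a"
    unfolding eq ratfun_eval_Fract[OF \<open>poly (q * s) a \<noteq> 0\<close>]
    using \<phi> \<psi> by (simp add: ratfun_eval_Fract)
qed

lemma ratfun_eval_inverse:
  assumes "ratfun_defined_at \<phi> a" "ratfun_eval \<phi> a \<noteq> 0"
  shows "ratfun_defined_at (inverse \<phi>) a" "ratfun_eval (inverse \<phi>) a = inverse (ratfun_eval \<phi> a)"
proof -
  obtain p q where \<phi>: "\<phi> = Fraction_Field.Fract p q" "poly q a \<noteq> 0"
    using assms unfolding ratfun_defined_at_def by blast
  then have p: "poly p a \<noteq> 0"
    using assms(2) by (auto simp: ratfun_eval_Fract)
  have eq: "inverse \<phi> = Fraction_Field.Fract q p"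
    using \<phi> by simp
  show "ratfun_defined_at (inverse \<phi>) a"
    unfolding ratfun_defined_at_def using eq p by blast
  show "ratfun_eval (inverse \<phi>) a = inverse (ratfun_eval \<phi> a)"
    unfolding eq using \<phi> p by (simp add: ratfun_eval_Fract)
qed

lemma ratfun_eval_to_fract:
  "ratfun_defined_at (to_fract p) a" "ratfun_eval (to_fract p) a = poly p a"
proof -
  have "poly 1 a \<noteq> 0"
    by simp
  then show "ratfun_defined_at (to_fract p) a" "ratfun_eval (to_fract p) a = poly p a"
    unfolding ratfun_defined_at_def to_fract_def by (blast, simp add: ratfun_eval_Fract)
qed

lemma ratfun_eval_const_ratfun:
  "ratfun_defined_at (const_ratfun c) a" "ratfun_eval (const_ratfun c) a = c"
  by (simp_all add: const_ratfun_def ratfun_eval_to_fract)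

lemma const_ratfun_in_Int_R: "c \<in> A \<Longrightarrow> const_ratfun c \<in> Int_R E A"
  by (simp add: Int_R_def ratfun_eval_const_ratfun)

lemma Int_R_mono: "A \<subseteq> B \<Longrightarrow> Int_R E A \<subseteq> Int_R E B"
  by (auto simp: Int_R_def)

lemma Int_R_mult:
  assumes "\<phi> \<in> Int_R E A" "\<psi> \<in> Int_R E B" "\<And>x y. x \<in> A \<Longrightarrow> y \<in> B \<Longrightarrow> x * y \<in> C"
  shows "\<phi> * \<psi> \<in> Int_R E C"
  using assms by (simp add: Int_R_def ratfun_eval_mult)

section \<open>Residues modulo \<open>m\<close>, and primes of rings of integer-valued rational
  functions\<close>

lemma finite_residue_system:
  assumes D: "subring D ring_of_type_algebra" and m: "ideal m (ring_on D)"
    and fin: "finite (carrier (ring_on D Quot m))"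
  shows "\<exists>F\<subseteq>D. finite F \<and> (\<forall>x\<in>D. \<exists>c\<in>F. x - c \<in> m)"
proof -
  define \<kappa> where "\<kappa> x = m +>\<^bsub>ring_on D\<^esub> x" for x
  have carrier: "carrier (ring_on D Quot m) = \<kappa> ` D"
    by (auto simp: FactRing_def A_RCOSETS_def' \<kappa>_def ring_on_simps)
  have coset: "\<kappa> x = (\<lambda>h. h + x) ` m" for x
    by (auto simp: \<kappa>_def a_r_coset_def' ring_of_type_algebra_def)
  obtain F where F: "F \<subseteq> D" "finite F" "\<kappa> ` D = \<kappa> ` F"
    using finite_subset_image[OF fin, of \<kappa> D] unfolding carrier by blast
  have "\<exists>c\<in>F. x - c \<in> m" if x: "x \<in> D" for x
  proof -
    obtain c where c: "c \<in> F" "\<kappa> x = \<kappa> c"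
      using imageI[OF x, of \<kappa>] unfolding F(3) by blast
    have "0 + x \<in> \<kappa> x"
      using m unfolding coset ideal_ring_on_iff[OF D] by blast
    then obtain h where "h \<in> m" "x = h + c"
      unfolding c(2) coset[of c] by auto
    then show ?thesis
      using c by (intro bexI[of _ c]) auto
  qed
  then show ?thesis
    using F by blast
qed

lemma primeideal_prod:
  assumes R: "subring R ring_of_type_algebra" and P: "primeideal P (ring_on R)"
    and "finite F" "\<And>c. c \<in> F \<Longrightarrow> f c \<in> R" "prod f F \<in> P"
  shows "\<exists>c\<in>F. f c \<in> P"
proof -
  note PR = P[unfolded primeideal_ring_on_iff[OF R]]
  from assms(3,4) have "prod f F \<in> R \<and> (prod f F \<in> P \<longrightarrow> (\<exists>c\<in>F. f c \<in> P))"
  proof (induction F rule: finite_induct)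
    case empty
    then show ?case
      using PR R by (auto simp: subring_type_algebra_iff)
  next
    case (insert c F)
    have "f c \<in> R" "prod f F \<in> R" "prod f F \<in> P \<longrightarrow> (\<exists>c\<in>F. f c \<in> P)"
      using insert by auto
    moreover have "f c * prod f F \<in> R"
      using calculation R by (auto simp: subring_type_algebra_iff)
    ultimately have "f c * prod f F \<in> R \<and>
      (f c * prod f F \<in> P \<longrightarrow> f c \<in> P \<or> (\<exists>c\<in>F. f c \<in> P))"
      using PR by blast
    then show ?case
      using insert.hyps by simp
  qed
  then show ?thesis
    using assms(5) by blast
qed

text \<open>For an ideal \<open>J\<close> common to \<open>R \<subseteq> T\<close>, the primes of \<open>R\<close> not containing \<open>J\<close> lift to \<open>T\<close>;
  \<open>\<rho>\<close> is an element of \<open>J\<close> outside the prime.\<close>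

lemma primeideal_lift:
  assumes R: "subring R ring_of_type_algebra" and T: "subring T ring_of_type_algebra" and "R \<subseteq> T"
    and P: "primeideal P (ring_on R)"
    and \<rho>: "\<rho> \<in> R" "\<rho> \<notin> P" and \<rho>T: "\<And>\<tau>. \<tau> \<in> T \<Longrightarrow> \<rho> * \<tau> \<in> R"
  shows "primeideal {\<tau> \<in> T. \<rho> * \<tau> \<in> P} (ring_on T)"
  unfolding primeideal_ring_on_iff[OF T]
proof (intro conjI ballI impI)
  note PR = P[unfolded primeideal_ring_on_iff[OF R]]
  have T': "1 \<in> T" "\<And>x y. x \<in> T \<Longrightarrow> y \<in> T \<Longrightarrow> x + y \<in> T" "\<And>x y. x \<in> T \<Longrightarrow> y \<in> T \<Longrightarrow> x * y \<in> T"
    using T by (auto simp: subring_type_algebra_iff)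
  have "0 \<in> T"
    using PR \<open>R \<subseteq> T\<close> by blast
  then show "0 \<in> {\<tau> \<in> T. \<rho> * \<tau> \<in> P}"
    using PR by simp
  show "1 \<notin> {\<tau> \<in> T. \<rho> * \<tau> \<in> P}"
    using \<rho> by simp
  show "x + y \<in> {\<tau> \<in> T. \<rho> * \<tau> \<in> P}" if "x \<in> {\<tau> \<in> T. \<rho> * \<tau> \<in> P}" "y \<in> {\<tau> \<in> T. \<rho> * \<tau> \<in> P}" for x y
    using that PR T' by (simp add: distrib_left)
  show "s * x \<in> {\<tau> \<in> T. \<rho> * \<tau> \<in> P}" if "s \<in> T" "x \<in> {\<tau> \<in> T. \<rho> * \<tau> \<in> P}" for s x
  proof -
    have x: "x \<in> T" "\<rho> * x \<in> P"
      using that by auto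
    \<comment> \<open>Since \<open>s\<close> itself may lie outside \<open>R\<close>, it is
      multiplied into \<open>R\<close> by a second factor \<open>\<rho>\<close>, which is then
      cancelled because \<open>\<rho>\<close> is not in the prime \<open>P\<close>.\<close>
    then have "(\<rho> * s) * (\<rho> * x) \<in> P"
      using PR \<rho>T[OF \<open>s \<in> T\<close>] by blast
    then have "\<rho> * (\<rho> * (s * x)) \<in> P"
      by (simp add: mult_ac)
    then have "\<rho> * (s * x) \<in> P"
      using PR \<rho> \<rho>T[OF T'(3)[OF \<open>s \<in> T\<close> x(1)]] by blast
    then show ?thesis
      using T' \<open>s \<in> T\<close> x by simp
  qed
  show "x \<in> {\<tau> \<in> T. \<rho> * \<tau> \<in> P} \<or> y \<in> {\<tau> \<in> T. \<rho> * \<tau> \<in> P}"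
    if xy: "x \<in> T" "y \<in> T" "x * y \<in> {\<tau> \<in> T. \<rho> * \<tau> \<in> P}" for x y
  proof -
    have "\<rho> * (\<rho> * (x * y)) \<in> P"
      using xy PR \<rho> by blast
    then have "(\<rho> * x) * (\<rho> * y) \<in> P"
      by (simp add: mult_ac)
    then have "\<rho> * x \<in> P \<or> \<rho> * y \<in> P"
      using PR \<rho>T xy by blast
    then show ?thesis
      using xy by simp
  qed
qed auto

lemma primeideal_trace:
  assumes D: "subring D ring_of_type_algebra" and T: "subring T ring_of_type_algebra"
    and DT: "\<And>c. c \<in> D \<Longrightarrow> const_ratfun c \<in> T" and Q: "primeideal Q (ring_on T)"
  shows "primeideal {c \<in> D. const_ratfun c \<in> Q} (ring_on D)"
proof -
  note QT = Q[unfolded primeideal_ring_on_iff[OF T]]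
  have D': "1 \<in> D" "- 1 \<in> D" "\<And>x y. x \<in> D \<Longrightarrow> y \<in> D \<Longrightarrow> x + y \<in> D"
    "\<And>x y. x \<in> D \<Longrightarrow> y \<in> D \<Longrightarrow> x * y \<in> D"
    using D by (auto simp: subring_type_algebra_iff)
  have "0 \<in> D"
    using D'(3)[OF D'(1,2)] by simp
  then show ?thesis
    unfolding primeideal_ring_on_iff[OF D] using D' QT DT by auto
qed

text \<open>The values of \<open>1 - \<rho>\<close> on \<open>E\<close> lie in \<open>V\<close> but
  outside \<open>m\<close>, hence are units of \<open>V\<close>, and the inverse can be taken
  pointwise. This keeps an ideal generated by a prime and an element of \<open>J\<close> from
  becoming the whole of \<open>T\<close>.\<close>

lemma Int_R_one_minus_inverse:
  assumes V: "valuation_ring V" and m: "maximalideal m (ring_on V)" and "E \<noteq> {}"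
    and \<rho>: "\<rho> \<in> Int_R E m"
  shows "inverse (1 + - 1 * \<rho>) \<in> Int_R E V" "1 + - 1 * \<rho> \<noteq> 0"
proof -
  have S: "subring V ring_of_type_algebra"
    using V unfolding valuation_ring_def by (auto dest: subdomain.axioms subcring.axioms)
  have V': "1 \<in> V" "- 1 \<in> V" "\<And>x y. x \<in> V \<Longrightarrow> y \<in> V \<Longrightarrow> x + y \<in> V" "\<And>x y. x \<in> V \<Longrightarrow> y \<in> V \<Longrightarrow> x * y \<in> V"
    using S by (auto simp: subring_type_algebra_iff)
  have mI: "ideal m (ring_on V)"
    using m by (rule maximalideal.axioms)
  then have m': "m \<subseteq> V" "0 \<in> m" "\<And>x y. x \<in> m \<Longrightarrow> y \<in> m \<Longrightarrow> x + y \<in> m"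
    "\<And>x y. x \<in> V \<Longrightarrow> y \<in> m \<Longrightarrow> x * y \<in> m"
    by (auto simp: ideal_ring_on_iff[OF S])
  have "m \<noteq> V"
    using maximalideal.I_notcarr[OF m] by (simp add: ring_on_simps)
  then have one: "1 \<notin> m"
    using m' by (metis mult.right_neutral subsetI subset_antisym)
  have unit: "1 + - 1 * x \<in> V" "1 + - 1 * x \<notin> m" if "x \<in> m" for x
  proof -
    show "1 + - 1 * x \<in> V"
      using V' m' that by blast
    show "1 + - 1 * x \<notin> m"
    proof
      assume "1 + - 1 * x \<in> m"
      then have "(1 + - 1 * x) + x \<in> m"
        using m' that by blast
      then show False
        using one by simp
    qed
  qed
  have eval: "ratfun_defined_at (1 + - 1 * \<rho>) a" "ratfun_eval (1 + - 1 * \<rho>) a = 1 + - 1 * ratfun_eval \<rho> a"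
    if "a \<in> E" for a
  proof -
    have \<rho>': "ratfun_defined_at \<rho> a"
      using \<rho> that by (simp add: Int_R_def)
    have const: "ratfun_defined_at 1 a" "ratfun_eval 1 a = 1" "ratfun_defined_at (- 1) a" "ratfun_eval (- 1) a = - 1"
      using ratfun_eval_to_fract[of 1 a] ratfun_eval_to_fract[of "- 1" a] by simp_all
    show "ratfun_defined_at (1 + - 1 * \<rho>) a" "ratfun_eval (1 + - 1 * \<rho>) a = 1 + - 1 * ratfun_eval \<rho> a"
      using ratfun_eval_add[OF const(1) ratfun_eval_mult(1)[OF const(3) \<rho>']]
        ratfun_eval_mult(2)[OF const(3) \<rho>'] const by simp_all
  qed
  have val: "ratfun_eval (1 + - 1 * \<rho>) a \<in> V" "ratfun_eval (1 + - 1 * \<rho>) a \<notin> m" if "a \<in> E" for a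
    using unit[of "ratfun_eval \<rho> a"] \<rho> that unfolding eval(2)[OF that] by (auto simp: Int_R_def)
  have nz: "ratfun_eval (1 + - 1 * \<rho>) a \<noteq> 0" if "a \<in> E" for a
    using val(2)[OF that] m' by metis
  show "inverse (1 + - 1 * \<rho>) \<in> Int_R E V"
    unfolding Int_R_def
    using ratfun_eval_inverse[OF eval(1) nz] valuation_ring_maximalideal_inverse[OF V m val]
    by simp
  obtain a where "a \<in> E"
    using \<open>E \<noteq> {}\<close> by blast
  show "1 + - 1 * \<rho> \<noteq> 0"
  proof
    assume "1 + - 1 * \<rho> = 0"
    then have "ratfun_eval (1 + - 1 * \<rho>) a = 0"
      using ratfun_eval_to_fract(2)[of 0 a] by simp
    then show False
      using nz \<open>a \<in> E\<close> by blast
  qed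
qed

text \<open>The finiteness of \<open>D/m\<close> enters here: it makes \<open>Int_R E D / Int_R E m\<close> integral over the
  image of \<open>D\<close>.\<close>

lemma Int_R_ideal_not_subset_nonmaximal_prime:
  assumes D: "subring D ring_of_type_algebra" and m: "maximalideal m (ring_on D)"
    and fin: "finite (carrier (ring_on D Quot m))"
    and P: "primeideal P (ring_on (Int_R E D))" and P': "primeideal P' (ring_on (Int_R E D))"
    and sub: "P \<subset> P'"
  shows "\<not> Int_R E m \<subseteq> P"
proof
  assume J: "Int_R E m \<subseteq> P"
  define R where "R = Int_R E D"
  have R: "subring R ring_of_type_algebra"
    unfolding R_def by (rule subring_Int_R[OF D])
  note PR = P[folded R_def, unfolded primeideal_ring_on_iff[OF R]]
    and PR' = P'[folded R_def, unfolded primeideal_ring_on_iff[OF R]]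
  have mI: "ideal m (ring_on D)"
    using m by (rule maximalideal.axioms)
  have m': "m \<subseteq> D" "\<And>x y. x \<in> D \<Longrightarrow> y \<in> m \<Longrightarrow> x * y \<in> m"
    using mI by (auto simp: ideal_ring_on_iff[OF D])
  have D': "1 \<in> D" "- 1 \<in> D" "\<And>x y. x \<in> D \<Longrightarrow> y \<in> D \<Longrightarrow> x + y \<in> D"
    "\<And>x y. x \<in> D \<Longrightarrow> y \<in> D \<Longrightarrow> x * y \<in> D"
    using D by (auto simp: subring_type_algebra_iff)
  have R': "1 \<in> R" "- 1 \<in> R" "\<And>x y. x \<in> R \<Longrightarrow> y \<in> R \<Longrightarrow> x + y \<in> R"
    "\<And>x y. x \<in> R \<Longrightarrow> y \<in> R \<Longrightarrow> x * y \<in> R"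
    using R by (auto simp: subring_type_algebra_iff)
  obtain F where F: "F \<subseteq> D" "finite F" "\<And>x. x \<in> D \<Longrightarrow> \<exists>c\<in>F. x - c \<in> m"
    using finite_residue_system[OF D mI fin] by blast
  obtain \<phi> where \<phi>: "\<phi> \<in> P'" "\<phi> \<notin> P"
    using sub by blast
  have \<phi>R: "\<phi> \<in> R"
    using \<phi> PR' by blast
  have const: "const_ratfun c \<in> R" if "c \<in> D" for c
    unfolding R_def by (rule const_ratfun_in_Int_R[OF that])
  define f where "f c = \<phi> + const_ratfun (- 1 * c)" for c
  have fR: "f c \<in> R" if "c \<in> F" for c
    unfolding f_def using that F(1) by (intro R' \<phi>R const D') auto
  have eval_f: "ratfun_defined_at (f c) a" "ratfun_eval (f c) a = ratfun_eval \<phi> a - c" if "a \<in> E" for a c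
  proof -
    have "ratfun_defined_at \<phi> a"
      using \<phi>R that by (simp add: R_def Int_R_def)
    from ratfun_eval_add[OF this ratfun_eval_const_ratfun(1)[of "- 1 * c" a]]
    show "ratfun_defined_at (f c) a" "ratfun_eval (f c) a = ratfun_eval \<phi> a - c"
      unfolding f_def ratfun_eval_const_ratfun(2) by auto
  qed
  \<comment> \<open>At each point of \<open>E\<close> the value of \<open>\<phi>\<close> is
    congruent modulo \<open>m\<close> to some representative \<open>c\<close> in \<open>F\<close>.
    The factor belonging to \<open>c\<close> then has its value in \<open>m\<close>, and the other
    factors have theirs in \<open>D\<close>.\<close>
  have "prod f F \<in> Int_R E m"
    unfolding Int_R_def mem_Collect_eq
  proof (intro ballI)
    fix a assume a: "a \<in> E"
    have eval_prod: "ratfun_defined_at (prod f G) a \<and> ratfun_eval (prod f G) a = (\<Prod>c\<in>G. ratfun_eval \<phi> a - c)"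
      if "finite G" for G
      using that
    proof (induction G rule: finite_induct)
      case empty
      then show ?case
        using ratfun_eval_to_fract[of 1 a] by simp
    next
      case (insert c G)
      then show ?case
        using ratfun_eval_mult[OF eval_f(1)[OF a, of c], of "prod f G"] eval_f(2)[OF a, of c] by simp
    qed
    have \<phi>a: "ratfun_eval \<phi> a \<in> D"
      using \<phi>R a by (simp add: R_def Int_R_def)
    then obtain c where c: "c \<in> F" "ratfun_eval \<phi> a - c \<in> m"
      using F by blast
    have "ratfun_eval \<phi> a - d \<in> D" if "d \<in> F" for d
      using D'(3)[OF \<phi>a D'(4)[OF D'(2)]] that F(1) by auto
    then have "(\<Prod>c\<in>F - {c}. ratfun_eval \<phi> a - c) \<in> D"
      by (intro prod_closed_ring_on[OF D]) auto
    then show "ratfun_defined_at (prod f F) a \<and> ratfun_eval (prod f F) a \<in> m"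
      using eval_prod[OF F(2)] prod.remove[OF F(2) c(1), of "\<lambda>c. ratfun_eval \<phi> a - c"]
        m'(2)[of "\<Prod>c\<in>F - {c}. ratfun_eval \<phi> a - c"] c(2) by (simp add: mult.commute)
  qed
  then have "prod f F \<in> P"
    using J by blast
  then have "\<exists>c\<in>F. f c \<in> P"
    using fR by (intro primeideal_prod[OF R P[folded R_def] F(2)])
  then obtain c where c: "c \<in> F" "f c \<in> P"
    by blast
  have cD: "c \<in> D"
    using c F by blast
  have "- 1 * f c + \<phi> \<in> P'"
    using c(2) sub \<phi> PR' R'(2) by blast
  also have "- 1 * f c + \<phi> = const_ratfun c"
    unfolding f_def by simp
  finally have cP': "const_ratfun c \<in> P'" .
  \<comment> \<open>\<open>\<phi>\<close> is congruent modulo \<open>P\<close> to the constant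
    \<open>c\<close>. For \<open>c\<close> in \<open>m\<close> this puts \<open>\<phi>\<close> into
    \<open>P\<close>; otherwise \<open>c\<close> is invertible modulo \<open>m\<close>, and
    \<open>P'\<close> would contain 1.\<close>
  show False
  proof (cases "c \<in> m")
    case True
    then have "const_ratfun c \<in> P"
      using J const_ratfun_in_Int_R by blast
    then have "f c + const_ratfun c \<in> P"
      using PR c by blast
    also have "f c + const_ratfun c = \<phi>"
      unfolding f_def by simp
    finally show False
      using \<phi> by blast
  next
    case False
    then obtain y \<mu> where y: "y \<in> D" "\<mu> \<in> m" "c * y + \<mu> = 1"
      using maximalideal_ring_on_comaximal[OF D m cD] by blast
    have "const_ratfun y * const_ratfun c \<in> P'" "const_ratfun \<mu> \<in> P'"
      using PR' cP' const[OF y(1)] J sub const_ratfun_in_Int_R[OF y(2)] by blast+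
    then have "const_ratfun y * const_ratfun c + const_ratfun \<mu> \<in> P'"
      using PR' by blast
    also have "const_ratfun y * const_ratfun c + const_ratfun \<mu> = const_ratfun (c * y + \<mu>)"
      by (simp add: mult.commute)
    finally show False
      using y PR' by simp
  qed
qed

subsection \<open>Chains of primes\<close>

text \<open>On the indices: the prime \<open>P (Suc n)\<close> makes \<open>P n\<close> non-maximal,
  so \<open>P n\<close> does not contain \<open>J\<close>, and the primes up to \<open>P n\<close>
  lift. The ideal \<open>Q'\<close> takes the place above them. The traces, with \<open>m\<close> on
  top, form a chain of \<open>n + 2\<close> primes of \<open>D\<close>, of which
  \<open>n + 1\<close> remain once a possible repetition is dropped.\<close>

lemma chain_primes_Int_R_imp_chain:
  assumes D: "subring D ring_of_type_algebra" and mD: "maximalideal m (ring_on D)"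
    and fin: "finite (carrier (ring_on D Quot m))"
    and V: "valuation_ring V" and DV: "D \<subseteq> V" and mV: "maximalideal m (ring_on V)"
    and E: "E \<noteq> {}"
    and P: "\<And>i. i \<le> Suc n \<Longrightarrow> primeideal (P i) (ring_on (Int_R E D))"
      "\<And>i. i < Suc n \<Longrightarrow> P i \<subset> P (Suc i)"
  shows "\<exists>P'. (\<forall>i\<le>n. primeideal (P' i) (ring_on D)) \<and> (\<forall>i<n. P' i \<subset> P' (Suc i))"
proof -
  have VS: "subring V ring_of_type_algebra"
    using V unfolding valuation_ring_def by (auto dest: subdomain.axioms subcring.axioms)
  define R T where "R = Int_R E D" and "T = Int_R E V"
  have R: "subring R ring_of_type_algebra" and T: "subring T ring_of_type_algebra"
    unfolding R_def T_def by (intro subring_Int_R D VS)+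
  have T': "1 \<in> T" "- 1 \<in> T" "\<And>x y. x \<in> T \<Longrightarrow> y \<in> T \<Longrightarrow> x + y \<in> T"
    "\<And>x y. x \<in> T \<Longrightarrow> y \<in> T \<Longrightarrow> x * y \<in> T"
    using T by (auto simp: subring_type_algebra_iff)
  have RT: "R \<subseteq> T"
    unfolding R_def T_def by (rule Int_R_mono[OF DV])
  note P = P[folded R_def]
  note PR = P(1)[unfolded primeideal_ring_on_iff[OF R]]
  have mID: "ideal m (ring_on D)" and mIV: "ideal m (ring_on V)"
    using mD mV by (auto dest: maximalideal.axioms)
  have m: "m \<subseteq> D" "\<And>x y. x \<in> m \<Longrightarrow> y \<in> V \<Longrightarrow> x * y \<in> m"
    using mID mIV unfolding ideal_ring_on_iff[OF D] ideal_ring_on_iff[OF VS]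
    by (blast, metis mult.commute)
  have mprime: "primeideal m (ring_on D)"
    by (rule cring.maximalideal_prime[OF cring_ring_on[OF D] mD])
  have "\<not> Int_R E m \<subseteq> P n"
    by (rule Int_R_ideal_not_subset_nonmaximal_prime[OF D mD fin P(1)[unfolded R_def] P(1)[unfolded R_def] P(2)])
      simp_all
  then obtain \<rho> where \<rho>: "\<rho> \<in> Int_R E m" "\<rho> \<notin> P n"
    by blast
  have \<rho>T: "\<rho> * \<tau> \<in> Int_R E m" if "\<tau> \<in> T" for \<tau>
    using Int_R_mult[OF \<rho>(1) _ m(2)] that unfolding T_def by blast
  have JR: "Int_R E m \<subseteq> R"
    unfolding R_def by (rule Int_R_mono[OF m(1)])
  \<comment> \<open>One \<open>\<rho>\<close> outside \<open>P n\<close> is outside every earlier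
    prime, so the whole chain is lifted with the same \<open>\<rho>\<close> and inclusions carry
    over directly.\<close>
  have "P i \<subseteq> P n" if "i \<le> n" for i
    using that by (induction i rule: inc_induct) (use P(2) in \<open>auto dest!: psubset_imp_subset simp: less_Suc_eq\<close>)
  then have \<rho>P: "\<rho> \<notin> P i" if "i \<le> n" for i
    using \<rho>(2) that by blast
  define Q where "Q i = {\<tau> \<in> T. \<rho> * \<tau> \<in> P i}" for i
  define Q' where "Q' = {x + \<rho> * \<tau> | x \<tau>. x \<in> Q n \<and> \<tau> \<in> T}"
  have Q: "primeideal (Q i) (ring_on T)" if "i \<le> n" for i
    unfolding Q_def using that \<rho> \<rho>P \<rho>T JR by (intro primeideal_lift[OF R T RT P(1)]) auto
  note QT = Q[unfolded primeideal_ring_on_iff[OF T]]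
  have Q_Suc: "Q i \<subset> Q (Suc i)" if "i < n" for i
  proof -
    have "P i \<subset> P (Suc i)"
      using P(2) that by simp
    then obtain x where x: "x \<in> P (Suc i)" "x \<notin> P i"
      by blast
    then have xR: "x \<in> R"
      using PR[of "Suc i"] that by auto
    then have "x \<in> T"
      using RT by blast
    \<comment> \<open>The same \<open>x\<close> separates the lifted primes, since neither
      \<open>\<rho>\<close> nor \<open>x\<close> lies in the prime \<open>P i\<close>.\<close>
    have "\<rho> * x \<in> P (Suc i)" "\<rho> * x \<notin> P i"
      using PR[of "Suc i"] PR[of i] \<rho>P[of i] \<rho>(1) JR x xR that by auto
    then have "x \<in> Q (Suc i)" "x \<notin> Q i"
      using \<open>x \<in> T\<close> by (auto simp: Q_def)
    moreover have "Q i \<subseteq> Q (Suc i)"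
      using P(2)[of i] that by (auto simp: Q_def)
    ultimately show ?thesis
      by blast
  qed
  have \<rho>_in_T: "\<rho> \<in> T"
    using \<rho>(1) JR RT by blast
  have zero: "0 \<in> T"
    using QT[of n] by auto
  have Q'_ideal: "ideal Q' (ring_on T)"
    unfolding ideal_ring_on_iff[OF T]
  proof (intro conjI ballI)
    note Qn = QT[OF order_refl]
    show "Q' \<subseteq> T"
    proof
      fix y assume "y \<in> Q'"
      then obtain x \<tau> where y: "y = x + \<rho> * \<tau>" "x \<in> Q n" "\<tau> \<in> T"
        unfolding Q'_def by blast
      then have "x \<in> T"
        using Qn by blast
      then show "y \<in> T"
        unfolding y(1) by (intro T' \<rho>_in_T y(3))
    qed
    have "0 + \<rho> * 0 \<in> Q'"
      unfolding Q'_def using Qn zero by blast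
    then show "0 \<in> Q'"
      by simp
    show "x + y \<in> Q'" if xy: "x \<in> Q'" "y \<in> Q'" for x y
    proof -
      obtain u \<sigma> v \<tau> where "x = u + \<rho> * \<sigma>" "y = v + \<rho> * \<tau>" "u \<in> Q n" "v \<in> Q n" "\<sigma> \<in> T" "\<tau> \<in> T"
        using xy unfolding Q'_def by blast
      then have "x + y = (u + v) + \<rho> * (\<sigma> + \<tau>)" "u + v \<in> Q n" "\<sigma> + \<tau> \<in> T"
        using Qn T' by (auto simp: algebra_simps)
      then show ?thesis
        unfolding Q'_def by blast
    qed
    show "s * x \<in> Q'" if sx: "s \<in> T" "x \<in> Q'" for s x
    proof -
      obtain u \<sigma> where "x = u + \<rho> * \<sigma>" "u \<in> Q n" "\<sigma> \<in> T"
        using sx unfolding Q'_def by blast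
      then have "s * x = s * u + \<rho> * (s * \<sigma>)" "s * u \<in> Q n" "s * \<sigma> \<in> T"
        using Qn T' sx by (auto simp: distrib_left mult.left_commute)
      then show ?thesis
        unfolding Q'_def by blast
    qed
  qed
  have Q_Q': "Q n \<subset> Q'"
  proof -
    have "x + \<rho> * 0 \<in> Q'" if "x \<in> Q n" for x
      unfolding Q'_def using that zero by blast
    moreover have "0 + \<rho> * 1 \<in> Q'"
      unfolding Q'_def using QT[OF order_refl] T' by blast
    moreover have "\<rho> \<notin> Q n"
      using PR[of n] \<rho> subsetD[OF JR \<rho>(1)] by (auto simp: Q_def)
    ultimately show ?thesis
      by auto
  qed
  have one_Q': "1 \<notin> Q'"
  proof
    assume "1 \<in> Q'"
    then obtain x \<tau> where x: "1 = x + \<rho> * \<tau>" "x \<in> Q n" "\<tau> \<in> T"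
      unfolding Q'_def by blast
    \<comment> \<open>As \<open>\<rho> * \<tau>\<close> lies in \<open>J\<close>, this exhibits an
      element of \<open>Q n\<close> as a unit of \<open>T\<close>.\<close>
    then have "x = 1 + - 1 * (\<rho> * \<tau>)"
      by (simp add: algebra_simps)
    then have "inverse x \<in> T" "x \<noteq> 0"
      using Int_R_one_minus_inverse[OF V mV E \<rho>T[OF x(3)]] unfolding T_def by auto
    then have "inverse x * x \<in> Q n"
      using QT[OF order_refl] x by blast
    then show False
      using \<open>x \<noteq> 0\<close> QT[OF order_refl] by simp
  qed
  have const_V: "const_ratfun c \<in> T" if "c \<in> V" for c
    unfolding T_def by (rule const_ratfun_in_Int_R[OF that])
  have trace_m: "c \<in> m"
    if "ideal I (ring_on T)" "1 \<notin> I" "c \<in> V" "const_ratfun c \<in> I" for I c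
  proof (rule ccontr)
    assume "c \<notin> m"
    then have "inverse c \<in> V"
      using valuation_ring_maximalideal_inverse[OF V mV] that by blast
    then have "const_ratfun (inverse c) * const_ratfun c \<in> I"
      using that const_V unfolding ideal_ring_on_iff[OF T] by blast
    then have "const_ratfun (inverse c * c) \<in> I"
      by simp
    moreover have "c \<noteq> 0"
      using \<open>c \<notin> m\<close> mID unfolding ideal_ring_on_iff[OF D] by blast
    ultimately show False
      using that by simp
  qed
  have Q_m: "c \<in> m" if "i \<le> n" "c \<in> V" "const_ratfun c \<in> Q i" for i c
    using trace_m[OF primeideal.axioms(1)[OF Q[OF that(1)]] _ that(2,3)] QT[OF that(1)] by blast
  \<comment> \<open>Beyond \<open>n\<close> the prime \<open>m\<close> is inserted instead of the
    trace of \<open>Q'\<close>: primality of \<open>Q'\<close> is not established, but as a proper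
    ideal it has its trace inside \<open>m\<close>.\<close>
  define p where "p i = (if i \<le> n then {c \<in> D. const_ratfun c \<in> Q i} else m)" for i
  have p: "primeideal (p i) (ring_on D)" for i
    unfolding p_def using primeideal_trace[OF D T _ Q] const_V DV mprime by auto
  \<comment> \<open>Restricting the trace from \<open>V\<close> to \<open>D\<close> loses nothing,
    because it already lies in \<open>m\<close>, which is contained in \<open>D\<close>.\<close>
  have p_iff: "c \<in> p i \<longleftrightarrow> const_ratfun c \<in> Q i" if "c \<in> V" "i \<le> n" for c i
    using Q_m[OF that(2,1)] m(1) that by (auto simp: p_def)
  have p_Suc: "p i \<subseteq> p (Suc i)" if "i \<le> n" for i
  proof (cases "i = n")
    case True
    then show ?thesis
      using Q_m DV by (auto simp: p_def)
  next
    case False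
    then show ?thesis
      using Q_Suc[of i] that by (auto simp: p_def)
  qed
  define QQ where "QQ i = (if i \<le> n then Q i else Q')" for i
  have QQ: "ideal (QQ i) (ring_on T)" for i
    using Q Q'_ideal by (auto simp: QQ_def dest: primeideal.axioms)
  have QQ_Suc: "QQ i \<subset> QQ (Suc i)" if "i \<le> n" for i
    using Q_Suc[of i] Q_Q' that by (cases "i = n") (auto simp: QQ_def)
  have QQ_p: "c \<in> p i" if "c \<in> V" "const_ratfun c \<in> QQ i" for c i
    using that p_iff[of c i] trace_m[OF Q'_ideal one_Q', of c] by (auto simp: QQ_def p_def split: if_splits)
  have Q_mono: "Q i \<subseteq> Q j" if "i \<le> j" "j \<le> n" for i j
    using that
  proof (induction j rule: dec_induct)
    case (step k)
    then show ?case
      using Q_Suc[of k] by auto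
  qed simp
  \<comment> \<open>For \<open>j = n\<close> the fourth ideal is \<open>Q'\<close>. Equality
    \<open>p n = m\<close> then says that its trace, lying in \<open>m\<close>, is contained in the
    trace of \<open>Q n\<close>.\<close>
  have not_two: "\<not> (p i = p (Suc i) \<and> p j = p (Suc j))" if "i < j" "j \<le> n" for i j
  proof
    assume eq: "p i = p (Suc i) \<and> p j = p (Suc j)"
    show False
    proof (rule not_two_repeated_traces[OF V T const_V, of "Q i" "Q (Suc i)" "Q j" "QQ (Suc j)"])
      show "primeideal (Q i) (ring_on T)" "primeideal (Q (Suc i)) (ring_on T)"
        "primeideal (Q j) (ring_on T)"
        using Q that by auto
      show "ideal (QQ (Suc j)) (ring_on T)"
        by (rule QQ)
      show "Q i \<subset> Q (Suc i)" "Q (Suc i) \<subseteq> Q j"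
        using Q_Suc Q_mono that by auto
      show "Q j \<subset> QQ (Suc j)"
        using QQ_Suc[of j] that by (simp add: QQ_def)
      show "const_ratfun c \<in> Q i" if "c \<in> V" "const_ratfun c \<in> Q (Suc i)" for c
        using p_iff[OF \<open>c \<in> V\<close>, of "Suc i"] p_iff[OF \<open>c \<in> V\<close>, of i] that eq \<open>i < j\<close> \<open>j \<le> n\<close> by auto
      show "const_ratfun c \<in> Q j" if "c \<in> V" "const_ratfun c \<in> QQ (Suc j)" for c
        using p_iff[OF \<open>c \<in> V\<close>, of j] QQ_p[OF that] eq \<open>j \<le> n\<close> by auto
    qed
  qed
  \<comment> \<open>\<open>i0\<close> is the only index at which the traces can repeat. If none
    repeats, the choice \<open>i0 = n\<close> makes \<open>P'\<close> drop the last entry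
    \<open>m\<close>.\<close>
  obtain i0 where i0: "i0 \<le> n" "\<And>i. i \<le> n \<Longrightarrow> i \<noteq> i0 \<Longrightarrow> p i \<subset> p (Suc i)"
  proof (cases "\<exists>i\<le>n. p i = p (Suc i)")
    case True
    then obtain i where i: "i \<le> n" "p i = p (Suc i)"
      by blast
    have "p j \<subset> p (Suc j)" if "j \<le> n" "j \<noteq> i" for j
    proof -
      have "p j \<noteq> p (Suc j)"
        using not_two[of i j] not_two[of j i] i that by (cases "i < j") auto
      then show ?thesis
        using p_Suc[OF that(1)] by blast
    qed
    then show thesis
      using that i(1) by blast
  next
    case False
    then show thesis
      using that[of n] p_Suc by blast
  qed
  \<comment> \<open>\<open>P'\<close> skips \<open>p (Suc i0)\<close>, so the step at
    \<open>i0\<close> runs from \<open>p i0\<close> to \<open>p (Suc (Suc i0))\<close> and is strict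
    because its second half is.\<close>
  define P' where "P' j = p (if j \<le> i0 then j else Suc j)" for j
  have "P' j \<subset> P' (Suc j)" if "j < n" for j
  proof -
    consider "j < i0" | "j = i0" | "j > i0"
      by linarith
    then show ?thesis
    proof cases
      case 1
      then show ?thesis
        using i0(2)[of j] that by (simp add: P'_def)
    next
      case 2
      then show ?thesis
        using p_Suc[of j] i0(2)[of "Suc j"] that by (auto simp: P'_def)
    next
      case 3
      then show ?thesis
        using i0(2)[of "Suc j"] that by (simp add: P'_def)
    qed
  qed
  moreover have "primeideal (P' j) (ring_on D)" for j
    unfolding P'_def by (rule p)
  ultimately show ?thesis
    by blast
qed

text \<open>Constants show that preimages under evaluation at \<open>a\<close> preserve strict
  inclusion. The extra prime at the bottom is zero, which differs from the preimage of
  \<open>p 0\<close> because some nonzero function in \<open>Int_R E D\<close> vanishes at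
  \<open>a\<close>.\<close>

lemma chain_imp_chain_primes_Int_R:
  assumes D: "subring D ring_of_type_algebra" and "fractional_subset D E" and "a \<in> E"
    and p: "\<And>i. i \<le> n \<Longrightarrow> primeideal (p i) (ring_on D)" "\<And>i. i < n \<Longrightarrow> p i \<subset> p (Suc i)"
  shows "\<exists>P. (\<forall>i\<le>Suc n. primeideal (P i) (ring_on (Int_R E D))) \<and> (\<forall>i<Suc n. P i \<subset> P (Suc i))"
proof -
  define R where "R = Int_R E D"
  have R: "subring R ring_of_type_algebra"
    unfolding R_def by (rule subring_Int_R[OF D])
  have D': "1 \<in> D" "- 1 \<in> D" "\<And>x y. x \<in> D \<Longrightarrow> y \<in> D \<Longrightarrow> x + y \<in> D"
    "\<And>x y. x \<in> D \<Longrightarrow> y \<in> D \<Longrightarrow> x * y \<in> D"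
    using D by (auto simp: subring_type_algebra_iff)
  have R': "1 \<in> R" "- 1 \<in> R" "\<And>x y. x \<in> R \<Longrightarrow> y \<in> R \<Longrightarrow> x + y \<in> R"
    "\<And>x y. x \<in> R \<Longrightarrow> y \<in> R \<Longrightarrow> x * y \<in> R"
    using R by (auto simp: subring_type_algebra_iff)
  have zero: "0 \<in> R"
    using R'(3)[OF R'(1,2)] by simp
  note pD = p(1)[unfolded primeideal_ring_on_iff[OF D]]
  have ev: "ratfun_defined_at \<phi> a" "ratfun_eval \<phi> a \<in> D" if "\<phi> \<in> R" for \<phi>
    using that \<open>a \<in> E\<close> by (auto simp: R_def Int_R_def)
  have ev01: "ratfun_eval 0 a = 0" "ratfun_eval 1 a = 1"
    using ratfun_eval_to_fract(2)[of 0 a] ratfun_eval_to_fract(2)[of 1 a] by simp_all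
  define P where "P i = (case i of 0 \<Rightarrow> {0} | Suc j \<Rightarrow> {\<phi> \<in> R. ratfun_eval \<phi> a \<in> p j})" for i
  have "primeideal (P i) (ring_on R)" if "i \<le> Suc n" for i
  proof (cases i)
    case 0
    then show ?thesis
      unfolding primeideal_ring_on_iff[OF R] by (simp add: P_def zero)
  next
    case (Suc j)
    then have "j \<le> n"
      using that by simp
    then show ?thesis
      unfolding primeideal_ring_on_iff[OF R] Suc P_def nat.case
      using pD[of j] R' zero by (simp add: ev01 ev ratfun_eval_add ratfun_eval_mult)
  qed
  moreover have "P i \<subset> P (Suc i)" if "i < Suc n" for i
  proof (cases i)
    case 0
    obtain d where d: "d \<in> D" "d \<noteq> 0" "\<And>e. e \<in> E \<Longrightarrow> d * e \<in> D"
      using \<open>fractional_subset D E\<close> unfolding fractional_subset_def by blast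
    \<comment> \<open>This is \<open>d * (X - a)\<close>: it vanishes at \<open>a\<close>, and its
      values \<open>d * e - d * a\<close> lie in \<open>D\<close> because \<open>d\<close> is a
      common denominator of \<open>E\<close>.\<close>
    define \<phi> where "\<phi> = to_fract [:- (d * a), d:]"
    have eval: "ratfun_defined_at \<phi> e" "ratfun_eval \<phi> e = d * e + - 1 * (d * a)" for e
      by (simp_all add: \<phi>_def ratfun_eval_to_fract)
    have "\<phi> \<in> R"
      unfolding R_def Int_R_def mem_Collect_eq eval(2)
      by (intro ballI conjI eval(1) D' d(3) \<open>a \<in> E\<close>)
    moreover have "\<phi> \<noteq> 0"
      using d by (simp add: \<phi>_def)
    moreover have "ratfun_eval \<phi> a \<in> p 0"
      using pD[of 0] by (simp add: eval(2))
    ultimately show ?thesis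
      using zero pD[of 0] 0 by (auto simp: P_def ev01)
  next
    case (Suc j)
    then have j: "j < n"
      using that by simp
    obtain c where c: "c \<in> p (Suc j)" "c \<notin> p j"
      using p(2)[OF j] by blast
    then have "const_ratfun c \<in> R"
      using pD[of "Suc j"] j unfolding R_def by (intro const_ratfun_in_Int_R) auto
    then have "const_ratfun c \<in> P (Suc i)" "const_ratfun c \<notin> P i"
      using c by (auto simp: Suc P_def ratfun_eval_const_ratfun)
    moreover have "P i \<subseteq> P (Suc i)"
      using p(2)[OF j] by (auto simp: Suc P_def)
    ultimately show ?thesis
      by blast
  qed
  ultimately show ?thesis
    unfolding R_def by blast
qed

theorem corollary1p21:
  fixes D V E m :: "'k::field set"
  assumes "pseudo_valuation_domain D"
    and "maximalideal m (ring_on D)"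
    and "associated_valuation_overring D m V"
    and "E \<noteq> {}"
    and "fractional_subset D E"
    and "E \<subseteq> V"
    and "finite (carrier (ring_on D Quot m))"
  shows "krull_dim (ring_on (Int_R E D)) = 1 + krull_dim (ring_on D)"
proof -
  have D: "subring D ring_of_type_algebra"
    using assms(1) unfolding pseudo_valuation_domain_def domain_with_quotient_field_def
    by (auto dest: subdomain.axioms subcring.axioms)
  have V: "valuation_ring V" "D \<subseteq> V" "maximalideal m (ring_on V)"
    using assms(3) by (simp_all add: associated_valuation_overring_def)
  obtain a where a: "a \<in> E"
    using assms(4) by blast
  define C where "C S = {enat n | n. \<exists>P :: nat \<Rightarrow> _ set.
    (\<forall>i\<le>n. primeideal (P i) (ring_on S)) \<and> (\<forall>i<n. P i \<subset> P (Suc i))}" for S :: "'k set"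
  define C' where "C' S = {enat n | n. \<exists>P :: nat \<Rightarrow> _ set.
    (\<forall>i\<le>n. primeideal (P i) (ring_on S)) \<and> (\<forall>i<n. P i \<subset> P (Suc i))}" for S :: "'k poly fract set"
  have "primeideal m (ring_on D)"
    by (rule cring.maximalideal_prime[OF cring_ring_on[OF D] assms(2)])
  \<comment> \<open>Nonemptiness is what lets the successor pass through the supremum: the supremum
    of the empty set is 0, also after applying \<open>eSuc\<close> elementwise.\<close>
  then have "enat 0 \<in> C D"
    unfolding C_def by auto
  then have "1 + Sup (C D) = Sup (eSuc ` C D)"
    using eSuc_Sup[of "C D"] by (auto simp: plus_1_eSuc)
  also have "\<dots> = Sup (C' (Int_R E D))"
  proof (rule antisym)
    show "Sup (eSuc ` C D) \<le> Sup (C' (Int_R E D))"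
    proof (rule Sup_least)
      fix x assume "x \<in> eSuc ` C D"
      then obtain n P where x: "x = enat (Suc n)" and P: "\<forall>i\<le>n. primeideal (P i) (ring_on D)"
        "\<forall>i<n. P i \<subset> P (Suc i)"
        unfolding C_def by (auto simp: eSuc_enat)
      have "x \<in> C' (Int_R E D)"
        using chain_imp_chain_primes_Int_R[OF D assms(5) a, of n P] P x unfolding C'_def by blast
      then show "x \<le> Sup (C' (Int_R E D))"
        by (rule Sup_upper)
    qed
    show "Sup (C' (Int_R E D)) \<le> Sup (eSuc ` C D)"
    proof (rule Sup_least)
      fix x assume "x \<in> C' (Int_R E D)"
      then obtain n P where x: "x = enat n" and P: "\<forall>i\<le>n. primeideal (P i) (ring_on (Int_R E D))"
        "\<forall>i<n. P i \<subset> P (Suc i)"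
        unfolding C'_def by blast
      show "x \<le> Sup (eSuc ` C D)"
      proof (cases n)
        case 0
        then show ?thesis
          using x by (simp add: zero_enat_def[symmetric])
      next
        case (Suc k)
        then have "enat k \<in> C D"
          using chain_primes_Int_R_imp_chain[OF D assms(2,7) V assms(4), of k P] P
          unfolding C_def by blast
        then have "x \<in> eSuc ` C D"
          using x Suc by (auto simp: eSuc_enat[symmetric])
        then show ?thesis
          by (rule Sup_upper)
      qed
    qed
  qed
  finally show ?thesis
    by (simp add: krull_dim_def C_def C'_def)
qed

end
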